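(* Let $G$ be a finite simple graph with $n$ vertices and $m\ge 1$ edges. Then \[NK(G^{---}) \le \left[(m+n-1)-\frac{4m}{n}\right]^{n}\left[(m+n-1)-\frac{1}{m}M_1(G)\right]^{m},\] with equality if and only if $G$ is a regular graph.
   Context: For a graph $H$, $NK(H)=\prod_{v\in V(H)} d_H(v)$ (Narumi-Katayama index). $M_1(G)=\sum_{v\in V(G)}d_G(v)^2=\sum_{uv\in E(G)}[d_G(u)+d_G(v)]$ is the first Zagreb index. For $x,y,z\in\{+,-\}$ the total transformation graph $G^{xyz}$ has vertex set $V(G)\cup E(G)$ (disjoint union) and two distinct vertices are adjacent as follows: two vertices of $G$ are adjacent iff they are adjacent in $G$ (if $x=+$), resp. non-adjacent in $G$ (if $x=-$); two edges of $G$ are adjacent iff they share an endpoint in $G$ (if $y=+$), resp. share no endpoint (if $y=-$); a vertex $u$ and an edge $e$ of $G$ are adjacent iff $u$ is incident to $e$ (if $z=+$), resp. not incident (if $z=-$). *)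

theory Defs
  imports Complex_Main
begin

text \<open>A graph is a pair of a vertex set and a set of edges, an edge being the set of its endpoints.\<close>

type_synonym 'a sgraph = "'a set \<times> 'a set set"

abbreviation verts :: "'a sgraph \<Rightarrow> 'a set" where
  "verts G \<equiv> fst G"

abbreviation edges :: "'a sgraph \<Rightarrow> 'a set set" where
  "edges G \<equiv> snd G"

definition finite_simple_graph :: "'a sgraph \<Rightarrow> bool" where
  "finite_simple_graph G \<longleftrightarrow>
     finite (verts G) \<and> (\<forall>e\<in>edges G. e \<subseteq> verts G \<and> card e = 2)"

definition adjacent :: "'a sgraph \<Rightarrow> 'a \<Rightarrow> 'a \<Rightarrow> bool" where
  "adjacent G u v \<longleftrightarrow> {u, v} \<in> edges G"

definition degree :: "'a sgraph \<Rightarrow> 'a \<Rightarrow> nat" where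
  "degree G v = card {e \<in> edges G. v \<in> e}"

definition regular :: "'a sgraph \<Rightarrow> bool" where
  "regular G \<longleftrightarrow> (\<exists>k. \<forall>v\<in>verts G. degree G v = k)"

definition narumi_katayama :: "'a sgraph \<Rightarrow> nat" where
  "narumi_katayama G = (\<Prod>v\<in>verts G. degree G v)"

definition first_zagreb :: "'a sgraph \<Rightarrow> nat" where
  "first_zagreb G = (\<Sum>v\<in>verts G. (degree G v)\<^sup>2)"

datatype sign = Plus | Minus

fun signed :: "sign \<Rightarrow> bool \<Rightarrow> bool" where
  "signed Plus P = P"
| "signed Minus P = (\<not> P)"

text \<open>The adjacency rule is only meaningful for two distinct vertices of the transformation graph;
  distinctness is imposed where the edge set is formed.\<close>

fun total_adjacent ::
  "sign \<Rightarrow> sign \<Rightarrow> sign \<Rightarrow> 'a sgraph \<Rightarrow> 'a + 'a set \<Rightarrow> 'a + 'a set \<Rightarrow> bool" where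
  "total_adjacent x y z G (Inl u) (Inl v) = signed x (adjacent G u v)"
| "total_adjacent x y z G (Inr e) (Inr f) = signed y (e \<inter> f \<noteq> {})"
| "total_adjacent x y z G (Inl u) (Inr e) = signed z (u \<in> e)"
| "total_adjacent x y z G (Inr e) (Inl u) = signed z (u \<in> e)"

definition total_transformation ::
  "sign \<Rightarrow> sign \<Rightarrow> sign \<Rightarrow> 'a sgraph \<Rightarrow> ('a + 'a set) sgraph" where
  "total_transformation x y z G =
     (verts G <+> edges G,
      {{p, q} | p q. p \<in> verts G <+> edges G \<and> q \<in> verts G <+> edges G \<and> p \<noteq> q \<and>
         total_adjacent x y z G p q})"

lemma finite_edges: "finite_simple_graph G \<Longrightarrow> finite (edges G)"
  unfolding finite_simple_graph_def
  by (rule finite_subset[of _ "Pow (verts G)"]) auto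

lemma total_adjacent_commute: "total_adjacent x y z G p q = total_adjacent x y z G q p"
  by (cases p; cases q) (auto simp: adjacent_def insert_commute Int_commute)

lemma finite_simple_graph_total_transformation:
  assumes "finite_simple_graph G"
  shows "finite_simple_graph (total_transformation x y z G)"
proof -
  have "finite (verts G <+> edges G)"
    using assms finite_edges[OF assms] by (simp add: finite_simple_graph_def)
  moreover have "e \<subseteq> verts G <+> edges G \<and> card e = 2"
    if "e \<in> edges (total_transformation x y z G)" for e
  proof -
    obtain p q where "e = {p, q}" "p \<in> verts G <+> edges G" "q \<in> verts G <+> edges G" "p \<noteq> q"
      using \<open>e \<in> edges (total_transformation x y z G)\<close>
      unfolding total_transformation_def snd_conv by blast
    then show ?thesis
      by (simp add: card_insert_if)
  qed
  ultimately show ?thesis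
    by (simp add: finite_simple_graph_def total_transformation_def)
qed

lemma adjacent_total_transformation:
  "adjacent (total_transformation x y z G) p q \<longleftrightarrow>
     p \<in> verts G <+> edges G \<and> q \<in> verts G <+> edges G \<and> p \<noteq> q \<and> total_adjacent x y z G p q"
  unfolding adjacent_def total_transformation_def snd_conv mem_Collect_eq doubleton_eq_iff
  using total_adjacent_commute[of x y z G p q] by blast

lemma first_zagreb_edges:
  assumes "finite_simple_graph G"
  shows "first_zagreb G = (\<Sum>e\<in>edges G. \<Sum>v\<in>e. degree G v)"
proof -
  have fin: "finite (verts G)" "finite (edges G)"
    using assms finite_edges[OF assms] by (simp_all add: finite_simple_graph_def)
  have "first_zagreb G = (\<Sum>v\<in>verts G. \<Sum>e\<in>{e \<in> edges G. v \<in> e}. degree G v)"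
    by (simp add: first_zagreb_def degree_def power2_eq_square)
  also have "\<dots> = (\<Sum>e\<in>edges G. \<Sum>v\<in>{v \<in> verts G. v \<in> e}. degree G v)"
    using sum.swap_restrict[OF fin, of "\<lambda>v e. degree G v" "\<lambda>v e. v \<in> e"] by simp
  also have "\<dots> = (\<Sum>e\<in>edges G. \<Sum>v\<in>e. degree G v)"
  proof (rule sum.cong)
    fix e assume "e \<in> edges G"
    then have "{v \<in> verts G. v \<in> e} = e"
      using assms by (auto simp: finite_simple_graph_def)
    then show "(\<Sum>v\<in>{v \<in> verts G. v \<in> e}. degree G v) = (\<Sum>v\<in>e. degree G v)"
      by simp
  qed simp
  finally show ?thesis .
qed

end

theory Submission imports Defs begin

text \<open>A vertex \<open>v\<close> has degree \<open>m + n - 1 - 2 d(v)\<close> in the transformation graph and an edge \<open>uv\<close> has degree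
  \<open>m + n - 1 - (d(u) + d(v))\<close>. Summing these over the vertices and over the edges separately
  gives the two bases of the bound, so the inequality is AM-GM applied to each of the two groups of
  factors. Equality for the vertices means that \<open>G\<close> is regular, and regularity gives equality for the
  edges too. The second factor of the bound vanishes only if \<open>n = 2\<close>, when \<open>G\<close> is a single edge,
  so a strict inequality for the vertices is never lost in the product.\<close>

text \<open>AM-GM in product form, with its equality case. After division by the mean,
  \<open>t \<le> exp (t - 1)\<close> is applied to each term; the exponents sum to 0, so the product
  of the bounds is 1. Equality in the pointwise bound holds only at \<open>t = 1\<close>.\<close>

lemma prod_le_power_mean:
  fixes x :: "'b \<Rightarrow> real"
  assumes "finite A" "A \<noteq> {}" and nonneg: "\<And>i. i \<in> A \<Longrightarrow> 0 \<le> x i"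
  defines "\<mu> \<equiv> sum x A / card A"
  shows "prod x A \<le> \<mu> ^ card A"
    and "prod x A = \<mu> ^ card A \<longleftrightarrow> (\<forall>i\<in>A. x i = \<mu>)"
proof -
  have card: "card A > 0"
    using assms by (simp add: card_gt_0_iff)
  have sum: "sum x A = card A * \<mu>"
    using card by (simp add: \<mu>_def)
  have "prod x A \<le> \<mu> ^ card A \<and> (prod x A = \<mu> ^ card A \<longrightarrow> (\<forall>i\<in>A. x i = \<mu>))"
  \<comment> \<open>Normalising by the mean needs it nonzero. If it is 0, all the nonnegative terms
    vanish and both sides are 0.\<close>
  proof (cases "\<mu> = 0")
    case True
    then have "sum x A = 0"
      by (simp add: sum)
    then have "\<forall>i\<in>A. x i = 0"
      using sum_nonneg_eq_0_iff[of A x] assms(1) nonneg by simp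
    moreover from this have "prod x A = (\<Prod>i\<in>A. 0)"
      by (intro prod.cong) auto
    ultimately show ?thesis
      using True by simp
  next
    case False
    have "\<mu> \<ge> 0"
      using sum_nonneg[of A x] nonneg by (simp add: \<mu>_def)
    with False have pos: "\<mu> > 0"
      by simp
    define y where "y i = x i / \<mu>" for i
    have y: "0 \<le> y i" "y i \<le> exp (y i - 1)" if "i \<in> A" for i
      using nonneg[OF that] pos exp_ge_add_one_self[of "y i - 1"] by (simp_all add: y_def)
    have prod_y: "prod x A = \<mu> ^ card A * prod y A"
      using pos by (simp add: y_def prod_dividef)
    have "(\<Sum>i\<in>A. y i - 1) = 0"
      using pos card by (simp add: y_def sum_subtractf sum flip: sum_divide_distrib)
    then have exp: "(\<Prod>i\<in>A. exp (y i - 1)) = 1"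
      by (simp flip: exp_sum[OF assms(1)])
    have "prod y A \<le> 1"
      using prod_mono[of A y "\<lambda>i. exp (y i - 1)"] y exp by simp
    moreover have "prod y A < 1" if "j \<in> A" "x j \<noteq> \<mu>" for j
    proof -
      have "y j \<noteq> 1"
        using that pos by (simp add: y_def)
      then have lt: "y j < exp (y j - 1)"
        using exp_minus_greater[of "1 - y j"] by simp
      have "prod y A = y j * prod y (A - {j})"
        using assms(1) that by (simp add: prod.remove)
      \<comment> \<open>The other factors are replaced first: some \<open>y i\<close> may be 0,
        whereas the exponentials are positive and preserve the strict inequality at
        \<open>j\<close>.\<close>
      also have "\<dots> \<le> y j * (\<Prod>i\<in>A - {j}. exp (y i - 1))"
        using y that by (intro mult_left_mono prod_mono) auto
      also have "\<dots> < exp (y j - 1) * (\<Prod>i\<in>A - {j}. exp (y i - 1))"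
        using lt by (intro mult_strict_right_mono prod_pos) auto
      also have "\<dots> = 1"
        using exp assms(1) that by (simp add: prod.remove)
      finally show ?thesis .
    qed
    ultimately have "prod y A \<le> 1" "prod y A = 1 \<longrightarrow> (\<forall>i\<in>A. x i = \<mu>)"
      by force+
    then show ?thesis
      using pos by (simp add: prod_y)
  qed
  then show "prod x A \<le> \<mu> ^ card A"
    and "prod x A = \<mu> ^ card A \<longleftrightarrow> (\<forall>i\<in>A. x i = \<mu>)"
    by auto
qed

text \<open>Neighbours \<open>u\<close> of \<open>v\<close> correspond to edges
  \<open>{v, u}\<close> at \<open>v\<close>. This allows degrees in the transformation graph to be
  read off from its adjacency rule.\<close>

lemma degree_eq_card_adjacent:
  assumes "finite_simple_graph G"
  shows "degree G v = card {u. adjacent G v u}"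
proof -
  have "(\<lambda>u. {v, u}) ` {u. adjacent G v u} = {e \<in> edges G. v \<in> e}"
  proof (intro equalityI subsetI)
    fix e assume e: "e \<in> {e \<in> edges G. v \<in> e}"
    then have "card e = 2"
      using assms by (simp add: finite_simple_graph_def)
    then obtain u where "e = {v, u}"
      using e by (auto simp: card_2_iff)
    with e show "e \<in> (\<lambda>u. {v, u}) ` {u. adjacent G v u}"
      by (auto simp: adjacent_def)
  qed (auto simp: adjacent_def)
  moreover have "inj_on (\<lambda>u. {v, u}) {u. adjacent G v u}"
    by (auto simp: inj_on_def doubleton_eq_iff)
  ultimately show ?thesis
    unfolding degree_def by (metis card_image)
qed

lemma adjacent_verts:
  assumes "finite_simple_graph G" "adjacent G u v"
  shows "u \<in> verts G" "v \<in> verts G" "u \<noteq> v"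
proof -
  have "{u, v} \<subseteq> verts G" "card {u, v} = 2"
    using assms unfolding finite_simple_graph_def adjacent_def by blast+
  then show "u \<in> verts G" "v \<in> verts G" "u \<noteq> v"
    by auto
qed

text \<open>Handshake lemma, by counting incidences from both sides.\<close>

lemma sum_degree:
  assumes "finite_simple_graph G"
  shows "(\<Sum>v\<in>verts G. degree G v) = 2 * card (edges G)"
proof -
  have fin: "finite (verts G)" "finite (edges G)"
    using assms finite_edges[OF assms] by (simp_all add: finite_simple_graph_def)
  have "(\<Sum>v\<in>verts G. degree G v) = (\<Sum>v\<in>verts G. \<Sum>e\<in>{e \<in> edges G. v \<in> e}. 1)"
    by (simp add: degree_def)
  also have "\<dots> = (\<Sum>e\<in>edges G. \<Sum>v\<in>{v \<in> verts G. v \<in> e}. 1)"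
    by (rule sum.swap_restrict[OF fin])
  also have "\<dots> = (\<Sum>e\<in>edges G. 2)"
  proof (rule sum.cong)
    fix e assume "e \<in> edges G"
    then have "e \<subseteq> verts G" "card e = 2"
      using assms by (simp_all add: finite_simple_graph_def)
    moreover from this have "{v \<in> verts G. v \<in> e} = e"
      by blast
    ultimately show "(\<Sum>v\<in>{v \<in> verts G. v \<in> e}. 1) = (2::nat)"
      by simp
  qed simp
  finally show ?thesis
    by simp
qed

text \<open>The neighbours are the \<open>n - 1 - d(v)\<close> other vertices not adjacent to
  \<open>v\<close> and the \<open>m - d(v)\<close> edges avoiding \<open>v\<close>. The additive
  form avoids truncated subtraction.\<close>

lemma degree_total_Inl:
  assumes G: "finite_simple_graph G" and v: "v \<in> verts G"
  shows "degree (total_transformation Minus Minus Minus G) (Inl v) + 2 * degree G v + 1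
    = card (edges G) + card (verts G)"
proof -
  let ?N = "{u. adjacent G v u}" and ?I = "{e \<in> edges G. v \<in> e}"
  have fin: "finite (verts G)" "finite (edges G)"
    using G finite_edges[OF G] by (simp_all add: finite_simple_graph_def)
  have N: "insert v ?N \<subseteq> verts G" "v \<notin> ?N"
    using adjacent_verts(2)[OF G] adjacent_verts(3)[OF G, of v v] v by auto
  have finN: "finite ?N"
    using finite_subset[OF N(1) fin(1)] by simp
  have "{q. adjacent (total_transformation Minus Minus Minus G) (Inl v) q}
    = (verts G - insert v ?N) <+> (edges G - ?I)"
    using v by (auto simp: adjacent_total_transformation)
  then have "degree (total_transformation Minus Minus Minus G) (Inl v)
    = card (verts G - insert v ?N) + card (edges G - ?I)"
    using fin by (simp add: degree_eq_card_adjacent[OF finite_simple_graph_total_transformation[OF G]] card_Plus)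
  moreover have "card (verts G - insert v ?N) + (degree G v + 1) = card (verts G)"
    using N fin finN card_mono[OF fin(1) N(1)]
    by (simp add: card_Diff_subset degree_eq_card_adjacent[OF G] del: insert_subset)
  moreover have "card (edges G - ?I) + degree G v = card (edges G)"
    using fin card_mono[of "edges G" ?I] by (simp add: card_Diff_subset degree_def)
  ultimately show ?thesis
    by simp
qed

text \<open>For \<open>e = uw\<close>, the neighbours are the \<open>n - 2\<close> vertices off
  \<open>e\<close> and the edges disjoint from \<open>e\<close>. The vertices alone give the second
  claim, which later makes the second base positive.\<close>

lemma degree_total_Inr:
  assumes G: "finite_simple_graph G" and e: "e \<in> edges G"
  shows "degree (total_transformation Minus Minus Minus G) (Inr e) + (\<Sum>v\<in>e. degree G v) + 1
      = card (edges G) + card (verts G)"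
    and "card (verts G) \<le> degree (total_transformation Minus Minus Minus G) (Inr e) + 2"
proof -
  let ?I = "\<lambda>v. {f \<in> edges G. v \<in> f}"
  have fin: "finite (verts G)" "finite (edges G)"
    using G finite_edges[OF G] by (simp_all add: finite_simple_graph_def)
  have e2: "e \<subseteq> verts G" "card e = 2"
    using G e by (simp_all add: finite_simple_graph_def)
  then obtain u w where uw: "e = {u, w}" "u \<noteq> w"
    by (auto simp: card_2_iff)
  \<comment> \<open>Only \<open>e\<close> contains both endpoints, so inclusion-exclusion gives
    \<open>d(u) + d(w) - 1\<close> edges meeting \<open>e\<close>, with \<open>e\<close> itself
    among them.\<close>
  have "?I u \<inter> ?I w = {e}"
  proof (intro equalityI subsetI)
    fix f assume f: "f \<in> ?I u \<inter> ?I w"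
    then have "card f = 2" "e \<subseteq> f"
      using G uw by (auto simp: finite_simple_graph_def)
    then show "f \<in> {e}"
      using e2 card_subset_eq[of f e] by (metis card.infinite singletonI zero_neq_numeral)
  qed (use e uw in auto)
  then have cardI: "card (?I u \<union> ?I w) + 1 = (\<Sum>v\<in>e. degree G v)"
    using card_Un_Int[of "?I u" "?I w"] fin uw by (simp add: degree_def)
  \<comment> \<open>Removing the edges that meet \<open>e\<close> also removes \<open>e\<close>, so
    distinctness needs no separate term.\<close>
  have "{q. adjacent (total_transformation Minus Minus Minus G) (Inr e) q}
    = (verts G - e) <+> (edges G - (?I u \<union> ?I w))"
    using e uw by (auto simp: adjacent_total_transformation)
  then have deg: "degree (total_transformation Minus Minus Minus G) (Inr e)
    = card (verts G - e) + card (edges G - (?I u \<union> ?I w))"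
    using fin by (simp add: degree_eq_card_adjacent[OF finite_simple_graph_total_transformation[OF G]] card_Plus)
  have V: "card (verts G - e) + 2 = card (verts G)"
    using e2 fin card_mono[OF fin(1) e2(1)] finite_subset[OF e2(1) fin(1)]
    by (simp add: card_Diff_subset)
  have sub: "?I u \<union> ?I w \<subseteq> edges G"
    by auto
  have E: "card (edges G - (?I u \<union> ?I w)) + card (?I u \<union> ?I w) = card (edges G)"
    using card_mono[OF fin(2) sub] card_Diff_subset[OF finite_subset[OF sub fin(2)] sub] by simp
  show "degree (total_transformation Minus Minus Minus G) (Inr e) + (\<Sum>v\<in>e. degree G v) + 1
      = card (edges G) + card (verts G)"
    using deg V E cardI by linarith
  show "card (verts G) \<le> degree (total_transformation Minus Minus Minus G) (Inr e) + 2"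
    using deg V by linarith
qed

text \<open>Any edge is the whole vertex set, so both vertices lie on every edge.\<close>

lemma regular_if_card_verts_eq_2:
  assumes "finite_simple_graph G" "card (verts G) = 2"
  shows "regular G"
proof -
  have "e = verts G" if "e \<in> edges G" for e
    using assms that card_subset_eq[of "verts G" e] by (simp add: finite_simple_graph_def)
  then have "{e \<in> edges G. v \<in> e} = edges G" if "v \<in> verts G" for v
    using that by auto
  then show ?thesis
    by (auto simp: regular_def degree_def)
qed

theorem theorem7:
  fixes G :: "'a sgraph" and n m :: nat
  assumes "finite_simple_graph G"
    and "n = card (verts G)"
    and "m = card (edges G)"
    and "m \<ge> 1"
  shows "real (narumi_katayama (total_transformation Minus Minus Minus G))
           \<le> ((real m + real n - 1) - 4 * real m / real n) ^ n *
              ((real m + real n - 1) - 1 / real m * real (first_zagreb G)) ^ m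
         \<and>
         (real (narumi_katayama (total_transformation Minus Minus Minus G))
           = ((real m + real n - 1) - 4 * real m / real n) ^ n *
              ((real m + real n - 1) - 1 / real m * real (first_zagreb G)) ^ m
          \<longleftrightarrow> regular G)"
proof -
  note G = assms(1)
  \<comment> \<open>The degree of a vertex in the complete graph on the \<open>m + n\<close>
    vertices of the transformation graph.\<close>
  define N where "N = real m + real n - 1"
  define x where "x v = real (degree (total_transformation Minus Minus Minus G) (Inl v))" for v
  define y where "y e = real (degree (total_transformation Minus Minus Minus G) (Inr e))" for e
  define a where "a = N - 4 * real m / real n"
  define b where "b = N - 1 / real m * real (first_zagreb G)"
  have fin: "finite (verts G)" "finite (edges G)"
    using G finite_edges[OF G] by (simp_all add: finite_simple_graph_def)
  have NK: "real (narumi_katayama (total_transformation Minus Minus Minus G))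
      = prod x (verts G) * prod y (edges G)"
    using fin by (simp add: narumi_katayama_def total_transformation_def prod.Plus x_def y_def)
  have "edges G \<noteq> {}"
    using assms by auto
  then obtain e\<^sub>0 where e0: "e\<^sub>0 \<in> edges G"
    by auto
  then have "e\<^sub>0 \<subseteq> verts G" "card e\<^sub>0 = 2"
    using G by (simp_all add: finite_simple_graph_def)
  \<comment> \<open>The endpoints of one edge: division by \<open>n\<close> is now genuine, and
    excluding \<open>n = 2\<close> later leaves \<open>n > 2\<close>.\<close>
  then have n: "n \<ge> 2"
    using card_mono[OF fin(1)] assms(2) by metis
  then have "verts G \<noteq> {}"
    using assms(2) by auto
  have x: "x v = N - 2 * real (degree G v)" if "v \<in> verts G" for v
    using degree_total_Inl[OF G that] assms by (simp add: x_def N_def)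
  have y: "y e = N - real (\<Sum>v\<in>e. degree G v)" "real n - 2 \<le> y e" if "e \<in> edges G" for e
    using degree_total_Inr[OF G that] assms by (simp_all add: y_def N_def del: of_nat_sum)
  have "sum x (verts G) = real n * N - 2 * real (\<Sum>v\<in>verts G. degree G v)"
    using assms by (simp add: x sum_subtractf sum_distrib_left)
  also have "\<dots> = real n * N - 4 * real m"
    using assms by (simp add: sum_degree[OF G] del: of_nat_sum)
  finally have a: "sum x (verts G) / card (verts G) = a"
    using n assms by (simp add: a_def field_simps)
  have "sum y (edges G) = real m * N - real (\<Sum>e\<in>edges G. \<Sum>v\<in>e. degree G v)"
    using assms by (simp add: y sum_subtractf)
  also have "\<dots> = real m * N - real (first_zagreb G)"
    by (simp add: first_zagreb_edges[OF G])
  finally have b: "sum y (edges G) / card (edges G) = b"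
    using assms by (simp add: b_def field_simps)
  have V: "prod x (verts G) \<le> a ^ n" "prod x (verts G) = a ^ n \<longleftrightarrow> (\<forall>v\<in>verts G. x v = a)"
    using prod_le_power_mean[of "verts G" x] fin \<open>verts G \<noteq> {}\<close> a assms by (simp_all add: x_def)
  have E: "prod y (edges G) \<le> b ^ m" "prod y (edges G) = b ^ m \<longleftrightarrow> (\<forall>e\<in>edges G. y e = b)"
    using prod_le_power_mean[of "edges G" y] fin \<open>edges G \<noteq> {}\<close> b assms by (simp_all add: y_def)
  have nonneg: "0 \<le> prod x (verts G)" "0 \<le> prod y (edges G)"
    by (auto simp: x_def y_def intro: prod_nonneg)
  have "prod x (verts G) * prod y (edges G) \<le> a ^ n * b ^ m"
    using V E nonneg by (intro mult_mono) auto
  moreover have "prod x (verts G) * prod y (edges G) = a ^ n * b ^ m" if "regular G"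
  proof -
    obtain k where k: "\<forall>v\<in>verts G. degree G v = k"
      using \<open>regular G\<close> by (auto simp: regular_def)
    have "x v = N - 2 * real k" if "v \<in> verts G" for v
      using that by (simp add: x k)
    \<comment> \<open>A constant family equals its mean; the edge factors are treated in the same
      way below.\<close>
    then have "\<forall>v\<in>verts G. x v = a"
      using a \<open>verts G \<noteq> {}\<close> fin by auto
    moreover have "y e = N - 2 * real k" if "e \<in> edges G" for e
    proof -
      have "e \<subseteq> verts G" "card e = 2"
        using G that by (simp_all add: finite_simple_graph_def)
      then have "(\<Sum>v\<in>e. degree G v) = (\<Sum>v\<in>e. k)"
        by (intro sum.cong) (auto simp: k)
      then show ?thesis
        using \<open>card e = 2\<close> that by (simp add: y(1) del: of_nat_sum)
    qed
    then have "\<forall>e\<in>edges G. y e = b"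
      using b \<open>edges G \<noteq> {}\<close> fin by auto
    ultimately show ?thesis
      using V E by simp
  qed
  moreover have "prod x (verts G) * prod y (edges G) < a ^ n * b ^ m" if "\<not> regular G"
  proof -
    \<comment> \<open>For \<open>n > 2\<close> the lower bound \<open>n - 2\<close> makes each
      \<open>y e\<close> positive, and hence their mean \<open>b\<close>.\<close>
    have "n \<noteq> 2"
      using that regular_if_card_verts_eq_2[OF G] assms by auto
    then have "y e > 0" if "e \<in> edges G" for e
      using y(2)[OF that] n by simp
    then have "sum y (edges G) > 0"
      using fin \<open>edges G \<noteq> {}\<close> by (intro sum_pos) auto
    then have "b > 0"
      using assms by (simp flip: b)
    \<comment> \<open>Equality would force \<open>x v = a\<close> throughout, and \<open>x v\<close>
      determines the degree of \<open>v\<close>.\<close>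
    have "prod x (verts G) \<noteq> a ^ n"
    proof
      assume "prod x (verts G) = a ^ n"
      then have d: "2 * real (degree G v) = N - a" if "v \<in> verts G" for v
        using V(2) x[OF that] that by auto
      have "degree G u = degree G v" if "u \<in> verts G" "v \<in> verts G" for u v
        using d[OF that(1)] d[OF that(2)] by simp
      with \<open>\<not> regular G\<close> show False
        unfolding regular_def by metis
    qed
    then have "prod x (verts G) < a ^ n"
      using V(1) by simp
    \<comment> \<open>Positivity of \<open>b\<close> keeps the inequality strict; replacing
      \<open>b ^ m\<close> by the edge product then only lowers the left side.\<close>
    then have "prod x (verts G) * b ^ m < a ^ n * b ^ m"
      using \<open>b > 0\<close> by simp
    then show ?thesis
      using mult_left_mono[OF E(1) nonneg(1)] by linarith
  qed
  ultimately show ?thesis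
    unfolding NK a_def[symmetric] b_def[symmetric] N_def[symmetric] by (metis less_irrefl)
qed

end
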